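(* Let $(\mathcal R_M,\mathcal R_V,\mathcal R_K)$ be an enf-bisimulation. Then $\widehat{\mathcal R_M}\cup\widehat{\mathcal R_V}\cup\widehat{\mathcal R_K}$ is a singleton bisimulation up-to composition in COGS.
   Context: Call-by-value $\lambda$-calculus $\Lambda_V$: values $V ::= x \mid \lambda x.M$, terms $M,N ::= V \mid MN$, evaluation contexts $E ::= [\cdot] \mid VE \mid EM$; reduction $\to_v$ is the least relation with $(\lambda x.M)V \to_v M\{V/x\}$ and $E[M]\to_v E[N]$ whenever $M\to_v N$. $M\Downarrow M'$ means $M\to_v^* M'$ with $M'$ an eager normal form (a value or a term $E[xV]$). An enf-bisimulation is a triple of relations $\mathcal R_M$ on terms, $\mathcal R_V$ on values, $\mathcal R_K$ on evaluation contexts such that: if $M_1\,\mathcal R_M\,M_2$ then either both $M_1,M_2$ diverge, or $M_1\Downarrow E_1[xV_1]$ and $M_2\Downarrow E_2[xV_2]$ for the same $x$ with $V_1\,\mathcal R_V\,V_2$ and $E_1\,\mathcal R_K\,E_2$, or $M_1\Downarrow V_1$ and $M_2\Downarrow V_2$ with $V_1\,\mathcal R_V\,V_2$; if $V_1\,\mathcal R_V\,V_2$ then $V_1x\,\mathcal R_M\,V_2x$ for some fresh $x$; if $E_1\,\mathcal R_K\,E_2$ then $E_1[x]\,\mathcal R_M\,E_2[x]$ for some fresh $x$. Names: variables and continuation names $p,q,r,\ldots$ (disjoint). Concurrent OGS (COGS): an environment $\gamma$ is a finite partial map sending variables to values and continuation names to pairs $(E,q)$; a running term $A$ is a finite partial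 map from continuation names to terms; configurations are $\langle A,\gamma,\phi\rangle$ ($\phi$ a finite set of names, $\mathrm{dom}(A)\cap\mathrm{dom}(\gamma)=\emptyset$); $\uplus$ is disjoint union. LTS $\to_C$: (P$\tau$) $\langle A\cdot[p\mapsto M],\gamma,\phi\rangle\xrightarrow{\tau}_C\langle A\cdot[p\mapsto N],\gamma,\phi\rangle$ if $M\to_v N$; (PA) $\langle A\cdot[p\mapsto V],\gamma,\phi\rangle\xrightarrow{\overline p(x)}_C\langle A,\gamma\cdot[x\mapsto V],\phi\uplus\{x\}\rangle$; (PQ) $\langle A\cdot[p\mapsto E[xV]],\gamma,\phi\rangle\xrightarrow{\overline x(y,q)}_C\langle A,\gamma\cdot[y\mapsto V]\cdot[q\mapsto(E,p)],\phi\uplus\{y,q\}\rangle$; (OA) $\langle A,\gamma\cdot[p\mapsto(E,q)],\phi\rangle\xrightarrow{p(x)}_C\langle A\cdot[q\mapsto E[x]],\gamma,\phi\uplus\{x\}\rangle$; (OQ) $\langle A,\gamma,\phi\rangle\xrightarrow{x(y,p)}_C\langle A\cdot[p\mapsto Vy],\gamma,\phi\uplus\{y,p\}\rangle$ if $\gamma(x)=V$. $\Rightarrow_C$ is the reflexive-transitive closure of $\xrightarrow{\tau}_C$. A configuration is singleton if it has one of the forms $\langle[p\mapsto M],\emptyset,\phi\rangle$, $\langle\emptyset,[x\mapsto V],\phi\rangle$, $\langle\emptyset,[p\mapsto(E,q)],\phi\rangle$ (written also $\langle[p\mapsto M],\phi\rangle$, $\langle[x\mapsto V],\phi\rangle$,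 $\langle[p\mapsto(E,q)],\phi\rangle$). Continuation structure of $\langle A,\gamma,\phi\rangle$: $(\mathrm{dom}(A),\{(p,q)\mid\gamma(p)=(E,q)\})$; a continuation name is available if in $\mathrm{dom}(A)$ or in a pair of this relation, variables always available; P-names: $\mathrm{dom}(A)\cup\mathrm{dom}(\gamma)$; O-names: available names of $\phi$ that are not P-names; the polarity function maps P-names to $P$, O-names to $O$. Support-equivalent: same polarity function and continuation structure; relations are required to relate only support-equivalent configurations. Compatible: polarity functions agree on common names; then $\langle A,\gamma,\phi\rangle\otimes\langle B,\delta,\phi'\rangle=\langle A\cdot B,\gamma\cdot\delta,\phi\cup\phi'\rangle$. For a relation $\mathcal R$, $\mathcal R^{\otimes}=\{(F_1\otimes G,F_2\otimes G)\mid F_1\,\mathcal R\,F_2\}$ and $\mathcal R^{\otimes*}$ is its reflexive-transitive closure. A relation $\mathcal R$ on singleton configurations is a singleton bisimulation up-to composition if whenever $F_1\,\mathcal R\,F_2$: if $F_1\Rightarrow_C\xrightarrow{\ell}_C F_1'$ for a non-$\tau$ action $\ell$ then $F_2\Rightarrow_C\xrightarrow{\ell}_C F_2'$ with $F_1'\,\mathcal R^{\otimes*}\,F_2'$, and symmetrically. Lifting: for a relation $\mathcal R$ on terms, values or evaluation contexts, $\widehat{\mathcal R}$ is the relation on singleton configurations containing: $(\langle[p\mapsto M_1],\emptyset,\phi\rangle,\langle[p\mapsto M_2],\emptyset,\phi\rangle)$ for $(M_1,M_2)\in\mathcal R$, $\phi$ the free variables of $M_1,M_2$ plus $p$; $(\langle[x\mapsto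 V_1],\phi\rangle,\langle[x\mapsto V_2],\phi\rangle)$ for $(V_1,V_2)\in\mathcal R$, $\phi$ the free variables of $V_1,V_2$ plus $x$; $(\langle[p\mapsto(E_1,q)],\phi\rangle,\langle[p\mapsto(E_2,q)],\phi\rangle)$ for $(E_1,E_2)\in\mathcal R$, $\phi$ the free variables of $E_1,E_2$ plus $p,q$.
   Formalization: In the enf-bisimulation, "for some fresh x" is taken as "for every fresh x", and in the lifting of values x is required not to be free in V1, V2; under the literal reading without either, the claim fails (e.g. relating λz.z and λz.(λu.u)z applied to only one variable). *)

theory Defs
  imports Main
begin

section \<open>Call-by-value lambda-calculus\<close>

type_synonym var = nat
type_synonym cname = nat

text \<open>
  Terms up to alpha-equivalence in locally nameless style: \<open>FV x\<close> is the (free) variable \<open>x\<close>,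
  \<open>BV i\<close> is an occurrence bound by the \<open>i\<close>-th enclosing \<open>Lam\<close>. The terms, values and evaluation
  contexts of the calculus are the elements of \<open>terms\<close>, \<open>vals\<close>, \<open>ectxs\<close> below, which have no
  dangling \<open>BV\<close>.
\<close>

datatype val = FV var | BV nat | Lam tm
     and tm = Val val | App tm tm

datatype ectx = Hole | AppR val ectx | AppL ectx tm

primrec lc_val :: "nat \<Rightarrow> val \<Rightarrow> bool" and lc_tm :: "nat \<Rightarrow> tm \<Rightarrow> bool" where
  "lc_val k (FV x) = True"
| "lc_val k (BV i) = (i < k)"
| "lc_val k (Lam M) = lc_tm (Suc k) M"
| "lc_tm k (Val V) = lc_val k V"
| "lc_tm k (App M N) = (lc_tm k M \<and> lc_tm k N)"

primrec lc_ectx :: "ectx \<Rightarrow> bool" where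
  "lc_ectx Hole = True"
| "lc_ectx (AppR V E) = (lc_val 0 V \<and> lc_ectx E)"
| "lc_ectx (AppL E M) = (lc_ectx E \<and> lc_tm 0 M)"

definition terms :: "tm set" where "terms = {M. lc_tm 0 M}"
definition vals :: "val set" where "vals = {V. lc_val 0 V}"
definition ectxs :: "ectx set" where "ectxs = {E. lc_ectx E}"

primrec fv_val :: "val \<Rightarrow> var set" and fv_tm :: "tm \<Rightarrow> var set" where
  "fv_val (FV x) = {x}"
| "fv_val (BV i) = {}"
| "fv_val (Lam M) = fv_tm M"
| "fv_tm (Val V) = fv_val V"
| "fv_tm (App M N) = fv_tm M \<union> fv_tm N"

primrec fv_ectx :: "ectx \<Rightarrow> var set" where
  "fv_ectx Hole = {}"
| "fv_ectx (AppR V E) = fv_val V \<union> fv_ectx E"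
| "fv_ectx (AppL E M) = fv_ectx E \<union> fv_tm M"

text \<open>
  \<open>inst_tm 0 U M\<close> is \<open>M{U/x}\<close> for \<open>Lam M\<close> standing for \<open>\<lambda>x. M\<close>. No index shifting is needed,
  since it is only used for \<open>U\<close> without dangling \<open>BV\<close>.
\<close>

primrec inst_val :: "nat \<Rightarrow> val \<Rightarrow> val \<Rightarrow> val" and inst_tm :: "nat \<Rightarrow> val \<Rightarrow> tm \<Rightarrow> tm" where
  "inst_val k U (FV x) = FV x"
| "inst_val k U (BV i) = (if i = k then U else BV i)"
| "inst_val k U (Lam M) = Lam (inst_tm (Suc k) U M)"
| "inst_tm k U (Val V) = Val (inst_val k U V)"
| "inst_tm k U (App M N) = App (inst_tm k U M) (inst_tm k U N)"

primrec plug :: "ectx \<Rightarrow> tm \<Rightarrow> tm" where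
  "plug Hole M = M"
| "plug (AppR V E) M = App (Val V) (plug E M)"
| "plug (AppL E N) M = App (plug E M) N"

inductive red :: "tm \<Rightarrow> tm \<Rightarrow> bool"  (infix \<open>\<rightarrow>\<^sub>v\<close> 50) where
  beta: "App (Val (Lam M)) (Val V) \<rightarrow>\<^sub>v inst_tm 0 V M"
| ctx: "M \<rightarrow>\<^sub>v N \<Longrightarrow> plug E M \<rightarrow>\<^sub>v plug E N"

abbreviation call :: "ectx \<Rightarrow> var \<Rightarrow> val \<Rightarrow> tm" where
  "call E x V \<equiv> plug E (App (Val (FV x)) (Val V))"

definition enf :: "tm \<Rightarrow> bool" where
  "enf M \<longleftrightarrow> (\<exists>V. M = Val V) \<or> (\<exists>E x V. M = call E x V)"

definition evals :: "tm \<Rightarrow> tm \<Rightarrow> bool"  (infix \<open>\<Down>\<close> 50) where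
  "M \<Down> M' \<longleftrightarrow> red\<^sup>*\<^sup>* M M' \<and> enf M'"

definition diverges :: "tm \<Rightarrow> bool" where
  "diverges M \<longleftrightarrow> (\<exists>f :: nat \<Rightarrow> tm. f 0 = M \<and> (\<forall>i. f i \<rightarrow>\<^sub>v f (Suc i)))"

text \<open>
  In the last two clauses the fresh variable is arbitrary. For relations closed under permutation
  of variables, some fresh variable and every fresh variable amount to the same.
\<close>

definition enf_bisimulation :: "tm rel \<Rightarrow> val rel \<Rightarrow> ectx rel \<Rightarrow> bool" where
  "enf_bisimulation RM RV RK \<longleftrightarrow>
     RM \<subseteq> terms \<times> terms \<and> RV \<subseteq> vals \<times> vals \<and> RK \<subseteq> ectxs \<times> ectxs \<and>
     (\<forall>M1 M2. (M1, M2) \<in> RM \<longrightarrow>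
        (diverges M1 \<and> diverges M2) \<or>
        (\<exists>E1 E2 x V1 V2. M1 \<Down> call E1 x V1 \<and> M2 \<Down> call E2 x V2 \<and>
           (V1, V2) \<in> RV \<and> (E1, E2) \<in> RK) \<or>
        (\<exists>V1 V2. M1 \<Down> Val V1 \<and> M2 \<Down> Val V2 \<and> (V1, V2) \<in> RV)) \<and>
     (\<forall>V1 V2. (V1, V2) \<in> RV \<longrightarrow>
        (\<forall>x. x \<notin> fv_val V1 \<union> fv_val V2 \<longrightarrow>
           (App (Val V1) (Val (FV x)), App (Val V2) (Val (FV x))) \<in> RM)) \<and>
     (\<forall>E1 E2. (E1, E2) \<in> RK \<longrightarrow>
        (\<forall>x. x \<notin> fv_ectx E1 \<union> fv_ectx E2 \<longrightarrow>
           (plug E1 (Val (FV x)), plug E2 (Val (FV x))) \<in> RM))"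


section \<open>Concurrent operational game semantics\<close>

datatype name = VName var | CName cname

text \<open>
  \<open>Conf A \<gamma>v \<gamma>k \<phi>\<close> is the triple with running term \<open>A\<close>, environment \<open>\<gamma>v \<cdot> \<gamma>k\<close> and name set \<open>\<phi>\<close>:
  the environment is split into its part on variables and its part on continuation names.
\<close>

datatype conf = Conf
  (running: "cname \<rightharpoonup> tm") (venv: "var \<rightharpoonup> val") (kenv: "cname \<rightharpoonup> ectx \<times> cname") (phi: "name set")

definition config :: "conf \<Rightarrow> bool" where
  "config F \<longleftrightarrow>
     finite (dom (running F)) \<and> finite (dom (venv F)) \<and> finite (dom (kenv F)) \<and> finite (phi F) \<and>
     dom (running F) \<inter> dom (kenv F) = {} \<and>
     ran (running F) \<subseteq> terms \<and> ran (venv F) \<subseteq> vals \<and> fst ` ran (kenv F) \<subseteq> ectxs"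

datatype action =
    Tau
  | PAns cname var
  | PQues var var cname
  | OAns cname var
  | OQues var var cname

text \<open>
  The side conditions on domains express that the extensions \<open>\<cdot>\<close> are by new names and that running
  term and environment keep disjoint domains; those on \<open>\<phi>\<close> express the disjoint union \<open>\<uplus>\<close>.
\<close>

inductive cogs :: "conf \<Rightarrow> action \<Rightarrow> conf \<Rightarrow> bool" where
  Ptau: "\<lbrakk>p \<notin> dom A; M \<rightarrow>\<^sub>v N\<rbrakk> \<Longrightarrow>
    cogs (Conf (A(p \<mapsto> M)) \<gamma>v \<gamma>k \<phi>) Tau (Conf (A(p \<mapsto> N)) \<gamma>v \<gamma>k \<phi>)"
| PA: "\<lbrakk>p \<notin> dom A; x \<notin> dom \<gamma>v; VName x \<notin> \<phi>\<rbrakk> \<Longrightarrow>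
    cogs (Conf (A(p \<mapsto> Val V)) \<gamma>v \<gamma>k \<phi>) (PAns p x)
         (Conf A (\<gamma>v(x \<mapsto> V)) \<gamma>k (\<phi> \<union> {VName x}))"
| PQ: "\<lbrakk>p \<notin> dom A; y \<notin> dom \<gamma>v; q \<notin> dom A; q \<notin> dom \<gamma>k; VName y \<notin> \<phi>; CName q \<notin> \<phi>\<rbrakk> \<Longrightarrow>
    cogs (Conf (A(p \<mapsto> call E x V)) \<gamma>v \<gamma>k \<phi>) (PQues x y q)
         (Conf A (\<gamma>v(y \<mapsto> V)) (\<gamma>k(q \<mapsto> (E, p))) (\<phi> \<union> {VName y, CName q}))"
| OA: "\<lbrakk>p \<notin> dom \<gamma>k; q \<notin> dom A; q \<notin> dom \<gamma>k; VName x \<notin> \<phi>\<rbrakk> \<Longrightarrow>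
    cogs (Conf A \<gamma>v (\<gamma>k(p \<mapsto> (E, q))) \<phi>) (OAns p x)
         (Conf (A(q \<mapsto> plug E (Val (FV x)))) \<gamma>v \<gamma>k (\<phi> \<union> {VName x}))"
| OQ: "\<lbrakk>\<gamma>v x = Some V; p \<notin> dom A; p \<notin> dom \<gamma>k; VName y \<notin> \<phi>; CName p \<notin> \<phi>\<rbrakk> \<Longrightarrow>
    cogs (Conf A \<gamma>v \<gamma>k \<phi>) (OQues x y p)
         (Conf (A(p \<mapsto> App (Val V) (Val (FV y)))) \<gamma>v \<gamma>k (\<phi> \<union> {VName y, CName p}))"

definition weak_cogs :: "conf \<Rightarrow> action \<Rightarrow> conf \<Rightarrow> bool" where
  "weak_cogs F l F' \<longleftrightarrow> (\<exists>F0. (\<lambda>G G'. cogs G Tau G')\<^sup>*\<^sup>* F F0 \<and> cogs F0 l F')"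

definition singleton :: "conf \<Rightarrow> bool" where
  "singleton F \<longleftrightarrow> config F \<and>
     ((\<exists>p M \<phi>. F = Conf [p \<mapsto> M] Map.empty Map.empty \<phi>) \<or>
      (\<exists>x V \<phi>. F = Conf Map.empty [x \<mapsto> V] Map.empty \<phi>) \<or>
      (\<exists>p E q \<phi>. F = Conf Map.empty Map.empty [p \<mapsto> (E, q)] \<phi>))"


section \<open>Polarities and composition\<close>

definition cont_structure :: "conf \<Rightarrow> cname set \<times> cname rel" where
  "cont_structure F = (dom (running F), {(p, q). \<exists>E. kenv F p = Some (E, q)})"

fun available :: "conf \<Rightarrow> name \<Rightarrow> bool" where
  "available F (VName x) = True"
| "available F (CName p) =
     (p \<in> fst (cont_structure F) \<or> p \<in> Field (snd (cont_structure F)))"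

definition pnames :: "conf \<Rightarrow> name set" where
  "pnames F = CName ` dom (running F) \<union> VName ` dom (venv F) \<union> CName ` dom (kenv F)"

definition onames :: "conf \<Rightarrow> name set" where
  "onames F = {n \<in> phi F. available F n \<and> n \<notin> pnames F}"

datatype polarity = Player | Opponent

definition pol :: "conf \<Rightarrow> name \<rightharpoonup> polarity" where
  "pol F n = (if n \<in> pnames F then Some Player else if n \<in> onames F then Some Opponent else None)"

definition support_equivalent :: "conf \<Rightarrow> conf \<Rightarrow> bool" where
  "support_equivalent F G \<longleftrightarrow> pol F = pol G \<and> cont_structure F = cont_structure G"

definition compatible :: "conf \<Rightarrow> conf \<Rightarrow> bool" where
  "compatible F G \<longleftrightarrow> (\<forall>n \<in> dom (pol F) \<inter> dom (pol G). pol F n = pol G n)"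

definition tensor :: "conf \<Rightarrow> conf \<Rightarrow> conf"  (infixl \<open>\<otimes>\<close> 70) where
  "F \<otimes> G = Conf (running F ++ running G) (venv F ++ venv G) (kenv F ++ kenv G) (phi F \<union> phi G)"

text \<open>
  Compatibility alone does not exclude a name that is a P-name on both sides; disjointness of the
  P-names makes \<open>A \<cdot> B\<close> and \<open>\<gamma> \<cdot> \<delta>\<close> disjoint extensions and the composite a configuration.
\<close>

definition composable :: "conf \<Rightarrow> conf \<Rightarrow> bool" where
  "composable F G \<longleftrightarrow> config F \<and> config G \<and> compatible F G \<and> pnames F \<inter> pnames G = {}"

definition comp_closure :: "conf rel \<Rightarrow> conf rel" where
  "comp_closure R =
     {(F1 \<otimes> G, F2 \<otimes> G) | F1 F2 G. (F1, F2) \<in> R \<and> composable F1 G \<and> composable F2 G}"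

definition singleton_bisim_upto_comp :: "conf rel \<Rightarrow> bool" where
  "singleton_bisim_upto_comp R \<longleftrightarrow>
     (\<forall>F1 F2. (F1, F2) \<in> R \<longrightarrow>
        singleton F1 \<and> singleton F2 \<and> support_equivalent F1 F2 \<and>
        (\<forall>l F1'. l \<noteq> Tau \<and> weak_cogs F1 l F1' \<longrightarrow>
           (\<exists>F2'. weak_cogs F2 l F2' \<and> (F1', F2') \<in> (comp_closure R)\<^sup>*)) \<and>
        (\<forall>l F2'. l \<noteq> Tau \<and> weak_cogs F2 l F2' \<longrightarrow>
           (\<exists>F1'. weak_cogs F1 l F1' \<and> (F1', F2') \<in> (comp_closure R)\<^sup>*)))"


section \<open>Lifting to singleton configurations\<close>

definition lift_tm :: "tm rel \<Rightarrow> conf rel" where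
  "lift_tm R = {(Conf [p \<mapsto> M1] Map.empty Map.empty \<phi>, Conf [p \<mapsto> M2] Map.empty Map.empty \<phi>) | p M1 M2 \<phi>.
     (M1, M2) \<in> R \<and> \<phi> = VName ` (fv_tm M1 \<union> fv_tm M2) \<union> {CName p}}"

text \<open>
  Free variables of \<open>V1\<close> and \<open>V2\<close> are to be O-names whereas \<open>x\<close> is a P-name, hence \<open>x\<close> is not
  one of them.
\<close>

definition lift_val :: "val rel \<Rightarrow> conf rel" where
  "lift_val R = {(Conf Map.empty [x \<mapsto> V1] Map.empty \<phi>, Conf Map.empty [x \<mapsto> V2] Map.empty \<phi>) | x V1 V2 \<phi>.
     (V1, V2) \<in> R \<and> x \<notin> fv_val V1 \<union> fv_val V2 \<and>
     \<phi> = VName ` (fv_val V1 \<union> fv_val V2) \<union> {VName x}}"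

definition lift_ectx :: "ectx rel \<Rightarrow> conf rel" where
  "lift_ectx R =
     {(Conf Map.empty Map.empty [p \<mapsto> (E1, q)] \<phi>, Conf Map.empty Map.empty [p \<mapsto> (E2, q)] \<phi>) | p q E1 E2 \<phi>.
     (E1, E2) \<in> R \<and> \<phi> = VName ` (fv_ectx E1 \<union> fv_ectx E2) \<union> {CName p, CName q}}"

end

theory Submission
  imports Defs
begin

text \<open>
  Reduction is deterministic and eager normal forms are irreducible and decompose uniquely, so a
  singleton term configuration has at most one visible action, up to the choice of fresh names; the
  enf-bisimulation clause for terms says that the related configuration can perform it too. The
  reached configurations split into singletons, which are exchanged one at a time inside a frame.
  Since reduction creates no free variables, the surplus names of \<open>\<phi>\<close> can be put into the frame.
\<close>

section \<open>Reduction\<close>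

lemma finite_fv: "finite (fv_val V)" "finite (fv_tm M)"
  by (induction V and M) auto

lemma finite_fv_ectx: "finite (fv_ectx E)"
  by (induction E) (auto simp: finite_fv)

lemma fv_plug: "fv_tm (plug E M) = fv_ectx E \<union> fv_tm M"
  by (induction E) auto

lemma fv_inst:
  "fv_val (inst_val k U V) \<subseteq> fv_val V \<union> fv_val U"
  "fv_tm (inst_tm k U M) \<subseteq> fv_tm M \<union> fv_val U"
proof (induction V and M arbitrary: k and k)
  case (Lam M)
  then show ?case by simp
next
  case (App M N)
  then show ?case by (simp, blast)
qed auto

lemma fv_red: "M \<rightarrow>\<^sub>v N \<Longrightarrow> fv_tm N \<subseteq> fv_tm M"
proof (induction rule: red.induct)
  case (beta M V)
  then show ?case using fv_inst(2)[of 0 V M] by simp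
qed (auto simp: fv_plug)

lemma fv_reds: "red\<^sup>*\<^sup>* M N \<Longrightarrow> fv_tm N \<subseteq> fv_tm M"
  by (induction rule: rtranclp_induct) (auto dest: fv_red)

lemma plug_App_neq_Val [simp]: "plug E (App M N) \<noteq> Val V" "Val V \<noteq> plug E (App M N)"
  by (cases E; simp)+

lemma unique_decomposition:
  "plug E (App (Val a) (Val b)) = plug E' (App (Val a') (Val b')) \<Longrightarrow> E = E' \<and> a = a' \<and> b = b'"
proof (induction E arbitrary: E')
  case Hole
  then show ?case by (cases E') auto
next
  case (AppR V E)
  then show ?case by (cases E') auto
next
  case (AppL E M)
  then show ?case by (cases E') auto
qed

primrec ectx_comp :: "ectx \<Rightarrow> ectx \<Rightarrow> ectx" where
  "ectx_comp Hole E' = E'"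
| "ectx_comp (AppR V E) E' = AppR V (ectx_comp E E')"
| "ectx_comp (AppL E M) E' = AppL (ectx_comp E E') M"

lemma plug_ectx_comp: "plug (ectx_comp E E') M = plug E (plug E' M)"
  by (induction E) auto

lemma red_redexE:
  assumes "M \<rightarrow>\<^sub>v N"
  obtains E B V where "M = plug E (App (Val (Lam B)) (Val V))" "N = plug E (inst_tm 0 V B)"
proof -
  from assms have "\<exists>E B V. M = plug E (App (Val (Lam B)) (Val V)) \<and> N = plug E (inst_tm 0 V B)"
  proof (induction rule: red.induct)
    case (beta M V)
    then show ?case by (metis plug.simps(1))
  next
    case (ctx M N E)
    then show ?case by (metis plug_ectx_comp)
  qed
  then show ?thesis using that by blast
qed

lemma red_deterministic: "M \<rightarrow>\<^sub>v N \<Longrightarrow> M \<rightarrow>\<^sub>v N' \<Longrightarrow> N = N'"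
  by (elim red_redexE) (auto dest!: unique_decomposition)

lemma enf_irreducible:
  assumes "enf M" shows "\<not> M \<rightarrow>\<^sub>v N"
proof
  assume "M \<rightarrow>\<^sub>v N"
  then obtain E B V where "M = plug E (App (Val (Lam B)) (Val V))"
    by (rule red_redexE)
  with assms show False
    unfolding enf_def by (auto dest!: unique_decomposition)
qed

lemma enf_call [simp]: "enf (call E x V)"
  unfolding enf_def by blast

lemma enf_Val [simp]: "enf (Val V)"
  unfolding enf_def by blast

lemma reds_to_enf:
  assumes "red\<^sup>*\<^sup>* M N" "red\<^sup>*\<^sup>* M N'" "enf N'"
  shows "red\<^sup>*\<^sup>* N N'"
  using assms
proof (induction rule: rtranclp_induct)
  case (step N N1)
  then have "red\<^sup>*\<^sup>* N N'" by blast
  then show ?case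
  proof (cases rule: converse_rtranclpE)
    case base
    then show ?thesis using step enf_irreducible by blast
  next
    case (step N2)
    then show ?thesis using \<open>N \<rightarrow>\<^sub>v N1\<close> red_deterministic by blast
  qed
qed

lemma evals_unique: "M \<Down> N \<Longrightarrow> M \<Down> N' \<Longrightarrow> N = N'"
  unfolding evals_def by (metis reds_to_enf enf_irreducible converse_rtranclpE)

lemma diverges_step:
  assumes "diverges M" "M \<rightarrow>\<^sub>v N" shows "diverges N"
proof -
  from assms(1) obtain f where f: "f 0 = M" "\<And>i. f i \<rightarrow>\<^sub>v f (Suc i)"
    unfolding diverges_def by blast
  then have "f (Suc 0) = N" using assms(2) red_deterministic by blast
  then show ?thesis
    unfolding diverges_def using f(2) by (intro exI[of _ "\<lambda>i. f (Suc i)"]) simp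
qed

lemma diverges_not_evals:
  assumes "diverges M" shows "\<not> M \<Down> N"
proof
  assume "M \<Down> N"
  then have "red\<^sup>*\<^sup>* M N" "enf N" unfolding evals_def by auto
  from this(1) have "diverges N"
    by (induction rule: rtranclp_induct) (auto intro: assms diverges_step)
  then show False
    using \<open>enf N\<close> enf_irreducible unfolding diverges_def by metis
qed


section \<open>Transitions of singleton configurations\<close>

abbreviation tm_conf :: "cname \<Rightarrow> tm \<Rightarrow> name set \<Rightarrow> conf" where
  "tm_conf p M \<phi> \<equiv> Conf [p \<mapsto> M] Map.empty Map.empty \<phi>"

abbreviation val_conf :: "var \<Rightarrow> val \<Rightarrow> name set \<Rightarrow> conf" where
  "val_conf x V \<phi> \<equiv> Conf Map.empty [x \<mapsto> V] Map.empty \<phi>"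

abbreviation ectx_conf :: "cname \<Rightarrow> ectx \<Rightarrow> cname \<Rightarrow> name set \<Rightarrow> conf" where
  "ectx_conf p E q \<phi> \<equiv> Conf Map.empty Map.empty [p \<mapsto> (E, q)] \<phi>"

abbreviation taus :: "conf \<Rightarrow> conf \<Rightarrow> bool" where
  "taus \<equiv> (\<lambda>G G'. cogs G Tau G')\<^sup>*\<^sup>*"

lemma singleton_map_upd_iff:
  assumes "p \<notin> dom A"
  shows "[q \<mapsto> b] = A(p \<mapsto> a) \<longleftrightarrow> q = p \<and> b = a \<and> A = Map.empty"
proof
  assume eq: "[q \<mapsto> b] = A(p \<mapsto> a)"
  then have qp: "q = p \<and> b = a"
    by (metis fun_upd_same fun_upd_other option.distinct(1) option.inject)
  have "A r = None" for r
    using assms eq qp by (cases "r = p") (auto simp: domIff dest!: fun_cong[of _ _ r])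
  then show "q = p \<and> b = a \<and> A = Map.empty" using qp by auto
qed auto

lemmas empty_neq_map_upd = map_upd_nonempty[THEN not_sym]

lemma tau_tm_conf:
  assumes "cogs (tm_conf p M \<phi>) Tau F"
  obtains N where "M \<rightarrow>\<^sub>v N" "F = tm_conf p N \<phi>"
  using assms by (cases rule: cogs.cases) (auto simp: singleton_map_upd_iff)

lemma taus_tm_confD:
  "taus (tm_conf p M \<phi>) F \<Longrightarrow> \<exists>N. red\<^sup>*\<^sup>* M N \<and> F = tm_conf p N \<phi>"
proof (induction rule: rtranclp_induct)
  case (step F F')
  then obtain N where N: "red\<^sup>*\<^sup>* M N" "F = tm_conf p N \<phi>" by blast
  from step(2)[unfolded N] obtain N' where "N \<rightarrow>\<^sub>v N'" "F' = tm_conf p N' \<phi>"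
    by (rule tau_tm_conf)
  moreover have "red\<^sup>*\<^sup>* M N'" using N(1) \<open>N \<rightarrow>\<^sub>v N'\<close> by simp
  ultimately show ?case by blast
qed blast

lemma taus_tm_confI: "red\<^sup>*\<^sup>* M N \<Longrightarrow> taus (tm_conf p M \<phi>) (tm_conf p N \<phi>)"
proof (induction rule: rtranclp_induct)
  case (step N N')
  have "cogs (tm_conf p N \<phi>) Tau (tm_conf p N' \<phi>)"
    using step Ptau[of p Map.empty N N'] by simp
  then show ?case using step by (meson rtranclp.rtrancl_into_rtrancl)
qed simp

lemma taus_no_running: "taus (Conf Map.empty \<gamma>v \<gamma>k \<phi>) F \<Longrightarrow> F = Conf Map.empty \<gamma>v \<gamma>k \<phi>"
  by (induction rule: rtranclp_induct) (auto elim!: cogs.cases simp: empty_neq_map_upd)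

lemma weak_cogs_tm_conf:
  assumes "weak_cogs (tm_conf p M \<phi>) l F" "l \<noteq> Tau"
  obtains (ans) x V where "l = PAns p x" "M \<Down> Val V" "VName x \<notin> \<phi>"
      "F = val_conf x V (\<phi> \<union> {VName x})"
    | (ques) x y q E V where "l = PQues x y q" "M \<Down> call E x V" "VName y \<notin> \<phi>" "CName q \<notin> \<phi>"
      "F = Conf Map.empty [y \<mapsto> V] [q \<mapsto> (E, p)] (\<phi> \<union> {VName y, CName q})"
proof -
  from assms(1) obtain N where N: "red\<^sup>*\<^sup>* M N" and step: "cogs (tm_conf p N \<phi>) l F"
    unfolding weak_cogs_def using taus_tm_confD by blast
  from step show ?thesis
  proof (cases rule: cogs.cases)
    case PA
    then show ?thesis
      using N by (intro ans) (auto simp: singleton_map_upd_iff evals_def)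
  next
    case PQ
    then show ?thesis
      using N by (intro ques) (auto simp: singleton_map_upd_iff evals_def)
  qed (use assms(2) in \<open>auto simp: empty_neq_map_upd\<close>)
qed

lemma weak_cogs_PAns:
  assumes "M \<Down> Val V" "VName x \<notin> \<phi>"
  shows "weak_cogs (tm_conf p M \<phi>) (PAns p x) (val_conf x V (\<phi> \<union> {VName x}))"
  unfolding weak_cogs_def
  using assms taus_tm_confI[of M "Val V" p \<phi>] PA[of p Map.empty x Map.empty \<phi> V Map.empty]
  by (auto simp: evals_def)

lemma weak_cogs_PQues:
  assumes "M \<Down> call E x V" "VName y \<notin> \<phi>" "CName q \<notin> \<phi>"
  shows "weak_cogs (tm_conf p M \<phi>) (PQues x y q)
    (Conf Map.empty [y \<mapsto> V] [q \<mapsto> (E, p)] (\<phi> \<union> {VName y, CName q}))"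
  unfolding weak_cogs_def
  using assms taus_tm_confI[of M "call E x V" p \<phi>]
    PQ[of p Map.empty y Map.empty q Map.empty \<phi> E x V]
  by (auto simp: evals_def)

lemma weak_cogs_val_conf:
  assumes "weak_cogs (val_conf x V \<phi>) l F" "l \<noteq> Tau"
  obtains y p where "l = OQues x y p" "VName y \<notin> \<phi>" "CName p \<notin> \<phi>"
    "F = Conf [p \<mapsto> App (Val V) (Val (FV y))] [x \<mapsto> V] Map.empty (\<phi> \<union> {VName y, CName p})"
proof -
  from assms(1) have "cogs (val_conf x V \<phi>) l F"
    unfolding weak_cogs_def using taus_no_running by blast
  then show ?thesis
    by (cases rule: cogs.cases)
      (use assms(2) that in \<open>auto simp: empty_neq_map_upd split: if_splits\<close>)
qed

lemma weak_cogs_OQues: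
  assumes "VName y \<notin> \<phi>" "CName p \<notin> \<phi>"
  shows "weak_cogs (val_conf x V \<phi>) (OQues x y p)
    (Conf [p \<mapsto> App (Val V) (Val (FV y))] [x \<mapsto> V] Map.empty (\<phi> \<union> {VName y, CName p}))"
  unfolding weak_cogs_def
  using assms OQ[of "[x \<mapsto> V]" x V p Map.empty Map.empty y \<phi>] by auto

lemma weak_cogs_ectx_conf:
  assumes "weak_cogs (ectx_conf p E q \<phi>) l F" "l \<noteq> Tau"
  obtains x where "l = OAns p x" "VName x \<notin> \<phi>"
    "F = tm_conf q (plug E (Val (FV x))) (\<phi> \<union> {VName x})"
proof -
  from assms(1) have "cogs (ectx_conf p E q \<phi>) l F"
    unfolding weak_cogs_def using taus_no_running by blast
  then show ?thesis
    by (cases rule: cogs.cases)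
      (use assms(2) that in \<open>auto simp: singleton_map_upd_iff empty_neq_map_upd\<close>)
qed

lemma weak_cogs_OAns:
  assumes "VName x \<notin> \<phi>"
  shows "weak_cogs (ectx_conf p E q \<phi>) (OAns p x)
    (tm_conf q (plug E (Val (FV x))) (\<phi> \<union> {VName x}))"
  unfolding weak_cogs_def
  using assms OA[of p Map.empty q Map.empty x \<phi> Map.empty E] by auto


section \<open>Exchanging a singleton inside a frame\<close>

lemma composableI:
  assumes "config F" "config G"
    and "pnames F \<inter> phi G = {}" "phi F \<inter> pnames G = {}" "pnames F \<inter> pnames G = {}"
  shows "composable F G"
  using assms unfolding composable_def compatible_def pol_def onames_def
  by (auto split: if_splits)

lemma comp_closureI:
  assumes "(F1, F2) \<in> R" "composable F1 G" "composable F2 G" "H1 = F1 \<otimes> G" "H2 = F2 \<otimes> G"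
  shows "(H1, H2) \<in> comp_closure R"
  using assms unfolding comp_closure_def by blast

lemma comp_closure_lift_tm:
  assumes "(M1, M2) \<in> RM" "lift_tm RM \<subseteq> R" "RM \<subseteq> terms \<times> terms"
    and "config (Conf Map.empty \<gamma>v \<gamma>k \<psi>)" "p \<notin> dom \<gamma>k" "CName p \<notin> \<psi>"
    and "(fv_tm M1 \<union> fv_tm M2) \<inter> dom \<gamma>v = {}"
    and "\<phi> = \<psi> \<union> VName ` (fv_tm M1 \<union> fv_tm M2) \<union> {CName p}"
  shows "(Conf [p \<mapsto> M1] \<gamma>v \<gamma>k \<phi>, Conf [p \<mapsto> M2] \<gamma>v \<gamma>k \<phi>) \<in> comp_closure R"
proof (rule comp_closureI)
  let ?\<phi> = "VName ` (fv_tm M1 \<union> fv_tm M2) \<union> {CName p}"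
  let ?G = "Conf Map.empty \<gamma>v \<gamma>k \<psi>"
  show "(tm_conf p M1 ?\<phi>, tm_conf p M2 ?\<phi>) \<in> R"
    using assms(1,2) unfolding lift_tm_def by blast
  show "composable (tm_conf p M1 ?\<phi>) ?G" "composable (tm_conf p M2 ?\<phi>) ?G"
    using assms by (intro composableI; auto simp: pnames_def config_def finite_fv)+
qed (use assms(8) in \<open>auto simp: tensor_def\<close>)

lemma comp_closure_lift_val:
  assumes "(V1, V2) \<in> RV" "lift_val RV \<subseteq> R" "RV \<subseteq> vals \<times> vals" "x \<notin> fv_val V1 \<union> fv_val V2"
    and "config (Conf A Map.empty \<gamma>k \<psi>)" "VName x \<notin> \<psi>"
    and "\<phi> = \<psi> \<union> VName ` (fv_val V1 \<union> fv_val V2) \<union> {VName x}"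
  shows "(Conf A [x \<mapsto> V1] \<gamma>k \<phi>, Conf A [x \<mapsto> V2] \<gamma>k \<phi>) \<in> comp_closure R"
proof (rule comp_closureI)
  let ?\<phi> = "VName ` (fv_val V1 \<union> fv_val V2) \<union> {VName x}"
  let ?G = "Conf A Map.empty \<gamma>k \<psi>"
  show "(val_conf x V1 ?\<phi>, val_conf x V2 ?\<phi>) \<in> R"
    using assms(1,2,4) unfolding lift_val_def by blast
  show "composable (val_conf x V1 ?\<phi>) ?G" "composable (val_conf x V2 ?\<phi>) ?G"
    using assms by (intro composableI; auto simp: pnames_def config_def finite_fv)+
qed (use assms(7) in \<open>auto simp: tensor_def\<close>)

lemma comp_closure_lift_ectx:
  assumes "(E1, E2) \<in> RK" "lift_ectx RK \<subseteq> R" "RK \<subseteq> ectxs \<times> ectxs"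
    and "config (Conf Map.empty \<gamma>v Map.empty \<psi>)" "CName p \<notin> \<psi>"
    and "(fv_ectx E1 \<union> fv_ectx E2) \<inter> dom \<gamma>v = {}"
    and "\<phi> = \<psi> \<union> VName ` (fv_ectx E1 \<union> fv_ectx E2) \<union> {CName p, CName q}"
  shows "(Conf Map.empty \<gamma>v [p \<mapsto> (E1, q)] \<phi>, Conf Map.empty \<gamma>v [p \<mapsto> (E2, q)] \<phi>)
    \<in> comp_closure R"
proof (rule comp_closureI)
  let ?\<phi> = "VName ` (fv_ectx E1 \<union> fv_ectx E2) \<union> {CName p, CName q}"
  let ?G = "Conf Map.empty \<gamma>v Map.empty \<psi>"
  show "(ectx_conf p E1 q ?\<phi>, ectx_conf p E2 q ?\<phi>) \<in> R"
    using assms(1,2) unfolding lift_ectx_def by blast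
  show "composable (ectx_conf p E1 q ?\<phi>) ?G" "composable (ectx_conf p E2 q ?\<phi>) ?G"
    using assms by (intro composableI; auto simp: pnames_def config_def finite_fv_ectx)+
qed (use assms(7) in \<open>auto simp: tensor_def\<close>)


section \<open>Simulation\<close>

abbreviation (input) lift_all :: "tm rel \<Rightarrow> val rel \<Rightarrow> ectx rel \<Rightarrow> conf rel" where
  "lift_all RM RV RK \<equiv> lift_tm RM \<union> lift_val RV \<union> lift_ectx RK"

lemma lift_tm_simulation:
  assumes bisim: "enf_bisimulation RM RV RK"
    and rel: "(F1, F2) \<in> lift_tm RM" and step: "weak_cogs F1 l F1'" "l \<noteq> Tau"
  shows "\<exists>F2'. weak_cogs F2 l F2' \<and> (F1', F2') \<in> (comp_closure (lift_all RM RV RK))\<^sup>*"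
proof -
  let ?R = "lift_all RM RV RK"
  have sub: "RV \<subseteq> vals \<times> vals" "RK \<subseteq> ectxs \<times> ectxs"
    and clause: "\<And>M1 M2. (M1, M2) \<in> RM \<Longrightarrow> (diverges M1 \<and> diverges M2) \<or>
        (\<exists>E1 E2 x V1 V2. M1 \<Down> call E1 x V1 \<and> M2 \<Down> call E2 x V2 \<and>
           (V1, V2) \<in> RV \<and> (E1, E2) \<in> RK) \<or>
        (\<exists>V1 V2. M1 \<Down> Val V1 \<and> M2 \<Down> Val V2 \<and> (V1, V2) \<in> RV)"
    using bisim unfolding enf_bisimulation_def by blast+
  from rel obtain p M1 M2 \<phi> where F: "F1 = tm_conf p M1 \<phi>" "F2 = tm_conf p M2 \<phi>"
    and M: "(M1, M2) \<in> RM" and \<phi>: "\<phi> = VName ` (fv_tm M1 \<union> fv_tm M2) \<union> {CName p}"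
    unfolding lift_tm_def by blast
  have fin: "finite \<phi>" using \<phi> by (simp add: finite_fv)
  have fv: "VName ` fv_tm N \<subseteq> \<phi>" if "M1 \<Down> N \<or> M2 \<Down> N" for N
    using that fv_reds \<phi> unfolding evals_def by blast
  from step(1)[unfolded F] step(2) show ?thesis
  proof (cases rule: weak_cogs_tm_conf)
    case (ans x V1)
    then obtain V2 where V2: "M2 \<Down> Val V2" "(V1, V2) \<in> RV"
      using clause[OF M] diverges_not_evals evals_unique
      by (metis plug_App_neq_Val(2) tm.inject(1))
    have "VName ` (fv_val V1 \<union> fv_val V2) \<subseteq> \<phi>"
      using fv[of "Val V1"] fv[of "Val V2"] ans V2 by auto
    then have "(F1', val_conf x V2 (\<phi> \<union> {VName x})) \<in> comp_closure ?R"
      unfolding \<open>F1' = _\<close> using ans(3) V2 sub fin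
      by (intro comp_closure_lift_val[where \<psi> = \<phi> and RV = RV]) (auto simp: config_def)
    then show ?thesis
      using weak_cogs_PAns[OF V2(1) ans(3)] F ans(1) by blast
  next
    case (ques x y q E1 V1)
    then obtain E2 V2 where V2: "M2 \<Down> call E2 x V2" "(V1, V2) \<in> RV" "(E1, E2) \<in> RK"
      using clause[OF M] diverges_not_evals evals_unique unique_decomposition
      by (metis (no_types, opaque_lifting) plug_App_neq_Val(1) val.inject(1))
    have fvs: "VName ` (fv_val V1 \<union> fv_val V2) \<subseteq> \<phi>" "VName ` (fv_ectx E1 \<union> fv_ectx E2) \<subseteq> \<phi>"
      using fv[of "call E1 x V1"] fv[of "call E2 x V2"] ques V2 by (auto simp: fv_plug)
    let ?\<phi> = "\<phi> \<union> {VName y, CName q}"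
    have "(Conf Map.empty [y \<mapsto> V1] [q \<mapsto> (E1, p)] ?\<phi>,
        Conf Map.empty [y \<mapsto> V2] [q \<mapsto> (E1, p)] ?\<phi>) \<in> comp_closure ?R"
      using fvs ques(3) V2 sub fin
      by (intro comp_closure_lift_val[where \<psi> = "\<phi> \<union> {CName q}" and RV = RV])
        (auto simp: config_def)
    moreover have "(Conf Map.empty [y \<mapsto> V2] [q \<mapsto> (E1, p)] ?\<phi>,
        Conf Map.empty [y \<mapsto> V2] [q \<mapsto> (E2, p)] ?\<phi>) \<in> comp_closure ?R"
      using fvs ques(3,4) V2 sub fin \<phi>
      by (intro comp_closure_lift_ectx[where \<psi> = "\<phi> \<union> {VName y}" and RK = RK])
        (auto simp: config_def)
    ultimately have "(F1', Conf Map.empty [y \<mapsto> V2] [q \<mapsto> (E2, p)] ?\<phi>) \<in> (comp_closure ?R)\<^sup>*"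
      unfolding \<open>F1' = _\<close> by (meson r_into_rtrancl rtrancl_trans)
    then show ?thesis
      using weak_cogs_PQues[OF V2(1) ques(3,4)] F ques(1) by blast
  qed
qed

lemma lift_val_simulation:
  assumes bisim: "enf_bisimulation RM RV RK"
    and rel: "(F1, F2) \<in> lift_val RV" and step: "weak_cogs F1 l F1'" "l \<noteq> Tau"
  shows "\<exists>F2'. weak_cogs F2 l F2' \<and> (F1', F2') \<in> (comp_closure (lift_all RM RV RK))\<^sup>*"
proof -
  let ?R = "lift_all RM RV RK"
  have sub: "RM \<subseteq> terms \<times> terms" "RV \<subseteq> vals \<times> vals"
    and clause: "\<And>V1 V2 x. (V1, V2) \<in> RV \<Longrightarrow> x \<notin> fv_val V1 \<union> fv_val V2 \<Longrightarrow>
      (App (Val V1) (Val (FV x)), App (Val V2) (Val (FV x))) \<in> RM"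
    using bisim unfolding enf_bisimulation_def by blast+
  from rel obtain x V1 V2 \<phi> where F: "F1 = val_conf x V1 \<phi>" "F2 = val_conf x V2 \<phi>"
    and V: "(V1, V2) \<in> RV" "x \<notin> fv_val V1 \<union> fv_val V2"
    and \<phi>: "\<phi> = VName ` (fv_val V1 \<union> fv_val V2) \<union> {VName x}"
    unfolding lift_val_def by blast
  have fin: "finite \<phi>" using \<phi> by (simp add: finite_fv)
  from step(1)[unfolded F] step(2) show ?thesis
  proof (cases rule: weak_cogs_val_conf)
    case (1 y p)
    let ?\<phi> = "\<phi> \<union> {VName y, CName p}"
    let ?M1 = "App (Val V1) (Val (FV y))" and ?M2 = "App (Val V2) (Val (FV y))"
    have "y \<notin> fv_val V1 \<union> fv_val V2" using 1 \<phi> by auto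
    then have M: "(?M1, ?M2) \<in> RM" using clause V(1) by blast
    have "(Conf [p \<mapsto> ?M1] [x \<mapsto> V1] Map.empty ?\<phi>, Conf [p \<mapsto> ?M2] [x \<mapsto> V1] Map.empty ?\<phi>)
        \<in> comp_closure ?R"
      using M V sub fin 1 \<phi>
      by (intro comp_closure_lift_tm[where \<psi> = \<phi> and RM = RM]) (auto simp: config_def)
    moreover have "(Conf [p \<mapsto> ?M2] [x \<mapsto> V1] Map.empty ?\<phi>, Conf [p \<mapsto> ?M2] [x \<mapsto> V2] Map.empty ?\<phi>)
        \<in> comp_closure ?R"
      using M V sub fin 1 \<phi>
      by (intro comp_closure_lift_val[where \<psi> = "?\<phi> - {VName x}" and RV = RV])
        (auto simp: config_def)
    ultimately have "(F1', Conf [p \<mapsto> ?M2] [x \<mapsto> V2] Map.empty ?\<phi>) \<in> (comp_closure ?R)\<^sup>*"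
      unfolding \<open>F1' = _\<close> by (meson r_into_rtrancl rtrancl_trans)
    then show ?thesis
      using weak_cogs_OQues[OF 1(2,3)] F 1(1) by blast
  qed
qed

lemma lift_ectx_simulation:
  assumes bisim: "enf_bisimulation RM RV RK"
    and rel: "(F1, F2) \<in> lift_ectx RK" and step: "weak_cogs F1 l F1'" "l \<noteq> Tau"
  shows "\<exists>F2'. weak_cogs F2 l F2' \<and> (F1', F2') \<in> (comp_closure (lift_all RM RV RK))\<^sup>*"
proof -
  let ?R = "lift_all RM RV RK"
  have sub: "RM \<subseteq> terms \<times> terms"
    and clause: "\<And>E1 E2 x. (E1, E2) \<in> RK \<Longrightarrow> x \<notin> fv_ectx E1 \<union> fv_ectx E2 \<Longrightarrow>
      (plug E1 (Val (FV x)), plug E2 (Val (FV x))) \<in> RM"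
    using bisim unfolding enf_bisimulation_def by blast+
  from rel obtain p q E1 E2 \<phi> where F: "F1 = ectx_conf p E1 q \<phi>" "F2 = ectx_conf p E2 q \<phi>"
    and E: "(E1, E2) \<in> RK"
    and \<phi>: "\<phi> = VName ` (fv_ectx E1 \<union> fv_ectx E2) \<union> {CName p, CName q}"
    unfolding lift_ectx_def by blast
  have fin: "finite \<phi>" using \<phi> by (simp add: finite_fv_ectx)
  from step(1)[unfolded F] step(2) show ?thesis
  proof (cases rule: weak_cogs_ectx_conf)
    case (1 x)
    let ?M1 = "plug E1 (Val (FV x))" and ?M2 = "plug E2 (Val (FV x))"
    have "x \<notin> fv_ectx E1 \<union> fv_ectx E2" using 1 \<phi> by auto
    then have M: "(?M1, ?M2) \<in> RM" using clause E by blast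
    have "(F1', tm_conf q ?M2 (\<phi> \<union> {VName x})) \<in> comp_closure ?R"
      unfolding \<open>F1' = _\<close> using M sub fin \<phi>
      by (intro comp_closure_lift_tm[where \<psi> = "\<phi> - {CName q}" and RM = RM])
        (auto simp: config_def fv_plug)
    then show ?thesis
      using weak_cogs_OAns[OF 1(2)] F 1(1) by blast
  qed
qed

lemma lift_all_simulation:
  assumes "enf_bisimulation RM RV RK" "(F1, F2) \<in> lift_all RM RV RK" "weak_cogs F1 l F1'" "l \<noteq> Tau"
  shows "\<exists>F2'. weak_cogs F2 l F2' \<and> (F1', F2') \<in> (comp_closure (lift_all RM RV RK))\<^sup>*"
  using assms(2) lift_tm_simulation[OF assms(1) _ assms(3,4)]
    lift_val_simulation[OF assms(1) _ assms(3,4)] lift_ectx_simulation[OF assms(1) _ assms(3,4)]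
  by (elim UnE)

lemma enf_bisimulation_converse:
  assumes "enf_bisimulation RM RV RK" shows "enf_bisimulation (RM\<inverse>) (RV\<inverse>) (RK\<inverse>)"
  unfolding enf_bisimulation_def
proof (intro conjI allI impI)
  note bisim = assms[unfolded enf_bisimulation_def]
  show "RM\<inverse> \<subseteq> terms \<times> terms" "RV\<inverse> \<subseteq> vals \<times> vals" "RK\<inverse> \<subseteq> ectxs \<times> ectxs"
    using bisim by blast+
  show "(diverges M1 \<and> diverges M2) \<or>
        (\<exists>E1 E2 x V1 V2. M1 \<Down> call E1 x V1 \<and> M2 \<Down> call E2 x V2 \<and>
           (V1, V2) \<in> RV\<inverse> \<and> (E1, E2) \<in> RK\<inverse>) \<or>
        (\<exists>V1 V2. M1 \<Down> Val V1 \<and> M2 \<Down> Val V2 \<and> (V1, V2) \<in> RV\<inverse>)"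
    if "(M1, M2) \<in> RM\<inverse>" for M1 M2
    using bisim that unfolding converse_iff by meson
  show "(App (Val V1) (Val (FV x)), App (Val V2) (Val (FV x))) \<in> RM\<inverse>"
    if "(V1, V2) \<in> RV\<inverse>" "x \<notin> fv_val V1 \<union> fv_val V2" for V1 V2 x
    using bisim that by blast
  show "(plug E1 (Val (FV x)), plug E2 (Val (FV x))) \<in> RM\<inverse>"
    if "(E1, E2) \<in> RK\<inverse>" "x \<notin> fv_ectx E1 \<union> fv_ectx E2" for E1 E2 x
    using bisim that by blast
qed

lemma lift_all_converse_subset: "(lift_all RM RV RK)\<inverse> \<subseteq> lift_all (RM\<inverse>) (RV\<inverse>) (RK\<inverse>)"
proof (rule subsetI, elim converseE)
  fix H F G assume "H = (G, F)" and rel: "(F, G) \<in> lift_all RM RV RK"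
  from rel consider "(F, G) \<in> lift_tm RM" | "(F, G) \<in> lift_val RV" | "(F, G) \<in> lift_ectx RK"
    by blast
  then have "(G, F) \<in> lift_all (RM\<inverse>) (RV\<inverse>) (RK\<inverse>)"
  proof cases
    case 1
    then obtain p M1 M2 \<phi> where "F = tm_conf p M1 \<phi>" "G = tm_conf p M2 \<phi>"
      "(M2, M1) \<in> RM\<inverse>" "\<phi> = VName ` (fv_tm M2 \<union> fv_tm M1) \<union> {CName p}"
      unfolding lift_tm_def by blast
    then show ?thesis unfolding lift_tm_def by blast
  next
    case 2
    then obtain x V1 V2 \<phi> where "F = val_conf x V1 \<phi>" "G = val_conf x V2 \<phi>"
      "(V2, V1) \<in> RV\<inverse>" "x \<notin> fv_val V2 \<union> fv_val V1"
      "\<phi> = VName ` (fv_val V2 \<union> fv_val V1) \<union> {VName x}"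
      unfolding lift_val_def by blast
    then show ?thesis unfolding lift_val_def by blast
  next
    case 3
    then obtain p q E1 E2 \<phi> where "F = ectx_conf p E1 q \<phi>" "G = ectx_conf p E2 q \<phi>"
      "(E2, E1) \<in> RK\<inverse>" "\<phi> = VName ` (fv_ectx E2 \<union> fv_ectx E1) \<union> {CName p, CName q}"
      unfolding lift_ectx_def by blast
    then show ?thesis unfolding lift_ectx_def by blast
  qed
  then show "H \<in> lift_all (RM\<inverse>) (RV\<inverse>) (RK\<inverse>)" using \<open>H = (G, F)\<close> by simp
qed

lemma lift_all_converse: "lift_all (RM\<inverse>) (RV\<inverse>) (RK\<inverse>) = (lift_all RM RV RK)\<inverse>"
proof
  have "(lift_all (RM\<inverse>) (RV\<inverse>) (RK\<inverse>))\<inverse> \<subseteq> lift_all RM RV RK"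
    using lift_all_converse_subset[of "RM\<inverse>" "RV\<inverse>" "RK\<inverse>"] by (simp only: converse_converse)
  then show "lift_all (RM\<inverse>) (RV\<inverse>) (RK\<inverse>) \<subseteq> (lift_all RM RV RK)\<inverse>"
    by (metis converse_converse converse_mono)
qed (rule lift_all_converse_subset)

lemma comp_closure_converse: "comp_closure (R\<inverse>) = (comp_closure R)\<inverse>"
  unfolding comp_closure_def by auto

lemma lift_all_singleton:
  assumes "enf_bisimulation RM RV RK" "(F1, F2) \<in> lift_all RM RV RK"
  shows "singleton F1 \<and> singleton F2"
proof -
  have sub: "RM \<subseteq> terms \<times> terms" "RV \<subseteq> vals \<times> vals" "RK \<subseteq> ectxs \<times> ectxs"
    using assms(1) unfolding enf_bisimulation_def by blast+
  have "config F1 \<and> config F2"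
    using assms(2) sub unfolding lift_tm_def lift_val_def lift_ectx_def
    by (auto simp: config_def finite_fv finite_fv_ectx)
  then show ?thesis
    using assms(2) unfolding singleton_def lift_tm_def lift_val_def lift_ectx_def by blast
qed

lemma lift_all_support_equivalent:
  assumes "(F1, F2) \<in> lift_all RM RV RK"
  shows "support_equivalent F1 F2"
proof -
  have "dom (running F1) = dom (running F2)"
      "dom (venv F1) = dom (venv F2)" "dom (kenv F1) = dom (kenv F2)" "phi F1 = phi F2"
    and cs: "cont_structure F1 = cont_structure F2"
    using assms unfolding lift_tm_def lift_val_def lift_ectx_def cont_structure_def
    by (auto split: if_splits)
  then have "pnames F1 = pnames F2" unfolding pnames_def by auto
  moreover have "available F1 n = available F2 n" for n
    using cs by (cases n) auto
  ultimately show ?thesis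
    using cs \<open>phi F1 = phi F2\<close> unfolding support_equivalent_def pol_def onames_def by auto
qed

theorem theorem8p1:
  fixes RM :: "tm rel" and RV :: "val rel" and RK :: "ectx rel"
  assumes "enf_bisimulation RM RV RK"
  shows "singleton_bisim_upto_comp (lift_tm RM \<union> lift_val RV \<union> lift_ectx RK)"
  unfolding singleton_bisim_upto_comp_def
proof (intro allI impI conjI)
  fix F1 F2
  assume rel: "(F1, F2) \<in> lift_all RM RV RK"
  show "singleton F1" "singleton F2"
    using lift_all_singleton[OF assms rel] by blast+
  show "support_equivalent F1 F2"
    using rel by (rule lift_all_support_equivalent)
  show "\<exists>F2'. weak_cogs F2 l F2' \<and> (F1', F2') \<in> (comp_closure (lift_all RM RV RK))\<^sup>*"
    if "l \<noteq> Tau \<and> weak_cogs F1 l F1'" for l F1'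
    using that lift_all_simulation[OF assms rel] by blast
  show "\<exists>F1'. weak_cogs F1 l F1' \<and> (F1', F2') \<in> (comp_closure (lift_all RM RV RK))\<^sup>*"
    if "l \<noteq> Tau \<and> weak_cogs F2 l F2'" for l F2'
    using that rel lift_all_simulation[OF enf_bisimulation_converse[OF assms], of F2 F1 l F2']
    by (simp add: lift_all_converse comp_closure_converse rtrancl_converse)
qed

end
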